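(* Let $n,k$ be integers with $1<k<n/2$, $k \neq n/2-1$, and $(n,k)\neq(10,3)$. Then $\chi_D(C_n(1,k)) \leq \chi(C_n(1,k))+1$.
   Context: For integers $n,k$ with $1< k< n/2$, the circulant graph $C_n(1,k)$ is the simple undirected ($4$-regular) graph with vertices $v_0,\dots,v_{n-1}$ (indices modulo $n$), where two distinct vertices $v_i,v_j$ are adjacent if and only if $i-j \equiv \pm 1$ or $i-j\equiv \pm k \pmod n$. $\chi(G)$ is the chromatic number. The distinguishing chromatic number $\chi_D(G)$ of a graph $G$ is the minimum number of colors in a proper vertex coloring of $G$ such that the only automorphism of $G$ preserving the color of every vertex is the identity. *)

theory Defs
  imports Complex_Main "HOL-Number_Theory.Cong"
begin

record 'a graph =
  verts :: "'a set"
  adj :: "'a \<Rightarrow> 'a \<Rightarrow> bool"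

definition simple_graph :: "'a graph \<Rightarrow> bool" where
  "simple_graph G \<longleftrightarrow>
     (\<forall>u v. adj G u v \<longrightarrow> u \<in> verts G \<and> v \<in> verts G \<and> u \<noteq> v \<and> adj G v u)"

definition circulant :: "nat \<Rightarrow> nat \<Rightarrow> nat graph" where
  "circulant n k =
     \<lparr> verts = {..<n},
       adj = (\<lambda>i j. i < n \<and> j < n \<and> i \<noteq> j \<and>
         ([int i - int j = 1] (mod int n) \<or> [int i - int j = - 1] (mod int n) \<or>
          [int i - int j = int k] (mod int n) \<or> [int i - int j = - int k] (mod int n))) \<rparr>"

definition proper_coloring :: "'a graph \<Rightarrow> ('a \<Rightarrow> nat) \<Rightarrow> bool" where
  "proper_coloring G c \<longleftrightarrow>
     (\<forall>u\<in>verts G. \<forall>v\<in>verts G. adj G u v \<longrightarrow> c u \<noteq> c v)"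

text \<open>Only the restriction of an automorphism to the vertex set is meaningful, so being the
  identity is also required on the vertex set only.\<close>

definition automorphism :: "'a graph \<Rightarrow> ('a \<Rightarrow> 'a) \<Rightarrow> bool" where
  "automorphism G \<phi> \<longleftrightarrow> bij_betw \<phi> (verts G) (verts G) \<and>
     (\<forall>u\<in>verts G. \<forall>v\<in>verts G. adj G (\<phi> u) (\<phi> v) \<longleftrightarrow> adj G u v)"

definition distinguishing :: "'a graph \<Rightarrow> ('a \<Rightarrow> nat) \<Rightarrow> bool" where
  "distinguishing G c \<longleftrightarrow>
     (\<forall>\<phi>. automorphism G \<phi> \<and> (\<forall>v\<in>verts G. c (\<phi> v) = c v) \<longrightarrow> (\<forall>v\<in>verts G. \<phi> v = v))"

text \<open>The two numbers below are meant for finite graphs, where they are attained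
  (by an injective coloring if nothing else).\<close>

definition chromatic_number :: "'a graph \<Rightarrow> nat" where
  "chromatic_number G =
     (LEAST m. \<exists>c. proper_coloring G c \<and> card (c ` verts G) = m)"

definition distinguishing_chromatic_number :: "'a graph \<Rightarrow> nat" where
  "distinguishing_chromatic_number G =
     (LEAST m. \<exists>c. proper_coloring G c \<and> distinguishing G c \<and> card (c ` verts G) = m)"

lemma simple_graph_circulant: "simple_graph (circulant n k)"
proof -
  have "[int j - int i = - x] (mod int n)" if "[int i - int j = x] (mod int n)" for i j x
    using that by (metis cong_minus_minus_iff minus_diff_eq)
  then show ?thesis
    unfolding simple_graph_def circulant_def by fastforce
qed

lemma ex_proper_distinguishing_coloring:
  assumes "finite (verts G)" "simple_graph G"
  shows "\<exists>c. proper_coloring G c \<and> distinguishing G c"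
proof -
  obtain c :: "'a \<Rightarrow> nat" where c: "inj_on c (verts G)"
    using finite_imp_inj_to_nat_seg[OF assms(1)] by blast
  have "proper_coloring G c"
    using c assms(2) unfolding proper_coloring_def simple_graph_def inj_on_def by blast
  moreover have "distinguishing G c"
    using c unfolding distinguishing_def automorphism_def
    by (meson bij_betwE inj_onD)
  ultimately show ?thesis by blast
qed

end

theory Submission
  imports Defs
begin

text \<open>Give a new color to an independent set \<open>S\<close> in an optimal coloring. The result is proper, and
  it is distinguishing if only the identity preserves \<open>S\<close>.

  Unless \<open>k = 3\<close>, the vertices \<open>x - 1\<close> and \<open>x + 1\<close> have no common neighbor besides \<open>x\<close>, while two
  neighbors of \<open>y\<close> that are not opposite always have a second one. So automorphisms preserve
  straight lines in direction \<open>1\<close>, that is, they are maps \<open>x \<mapsto> b + s x\<close> with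
  \<open>s \<in> {\<plusminus>1, \<plusminus>k}\<close>. If \<open>k = 3\<close>, the differences \<open>\<plusminus>2\<close> are characterized by having three common
  neighbors, and the automorphisms are the maps \<open>x \<mapsto> b \<plusminus> x\<close>. A set \<open>S = {0, a, a + b}\<close> with three
  distinct cyclic gaps \<open>a\<close>, \<open>b\<close>, \<open>n - a - b\<close> has trivial stabilizer among the latter maps, and
  the case \<open>s = \<plusminus>k\<close> is excluded by arithmetic. The few graphs that are too small for such a set
  are not bipartite and have explicit distinguishing \<open>4\<close>-colorings (\<open>n = 5\<close> gives \<open>K\<^sub>5\<close>).\<close>

section \<open>Maps modulo \<open>n\<close>\<close>

lemma dvd_small_cases:
  fixes n d :: int
  assumes "n dvd d" "\<bar>d\<bar> < 2 * n"
  shows "d = 0 \<or> d = n \<or> d = - n"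
proof -
  obtain q where q: "d = n * q"
    using assms(1) by blast
  have "n > 0"
    using assms(2) by linarith
  then have "\<bar>q\<bar> < 2"
    using assms(2) unfolding q by (simp add: abs_mult)
  then have "q = 0 \<or> q = 1 \<or> q = - 1"
    by linarith
  then show ?thesis
    unfolding q by auto
qed

lemma dvd_diff_trans:
  fixes n a b c :: int
  assumes "n dvd a - b" "n dvd b - c"
  shows "n dvd a - c"
  using dvd_add[OF assms] by simp

text \<open>The recurrence \<open>f (l + 2) = 2 * f (l + 1) - f l\<close> modulo \<open>n\<close>
  determines \<open>f\<close> from \<open>f 0\<close> and \<open>f 1\<close>. Nonnegative arguments
  suffice, since they include all vertices.\<close>

lemma affine_if_second_difference_zero:
  fixes n :: int and f :: "int \<Rightarrow> int"
  assumes "\<And>x. n dvd f (x + 1) + f (x - 1) - 2 * f x"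
  shows "n dvd f (int m) - f 0 - int m * (f 1 - f 0)"
proof (induction m rule: less_induct)
  case (less m)
  consider "m = 0" | "m = 1" | l where "m = l + 2"
    by (metis One_nat_def Suc_1 add.commute add_2_eq_Suc not0_implies_Suc)
  then show ?case
  proof cases
    case 3
    have "n dvd f (int l) - f 0 - int l * (f 1 - f 0)"
      "n dvd f (int (l + 1)) - f 0 - int (l + 1) * (f 1 - f 0)"
      using less[of l] less[of "l + 1"] 3 by simp_all
    moreover have "n dvd f (int m) + f (int l) - 2 * f (int (l + 1))"
      using assms[of "int (l + 1)"] 3 by (simp add: add.commute)
    ultimately have "n dvd (f (int m) + f (int l) - 2 * f (int (l + 1)))
      + 2 * (f (int (l + 1)) - f 0 - int (l + 1) * (f 1 - f 0))
      - (f (int l) - f 0 - int l * (f 1 - f 0))"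
      by (meson dvd_add dvd_diff dvd_mult)
    then show ?thesis
      by (simp add: 3 algebra_simps)
  qed auto
qed

definition step :: "int \<Rightarrow> int \<Rightarrow> int \<Rightarrow> bool" where
  "step n k d \<longleftrightarrow> n dvd d - 1 \<or> n dvd d + 1 \<or> n dvd d - k \<or> n dvd d + k"

lemma step_cong: "n dvd d - e \<Longrightarrow> step n k d \<longleftrightarrow> step n k e"
  unfolding step_def
  by (smt (verit, ccfv_SIG) dvd_diff_trans dvd_minus_iff minus_diff_eq diff_minus_eq_add)

lemma step_minus: "step n k (- d) \<longleftrightarrow> step n k d"
proof -
  have "- d - e = - (d + e)" "- d + e = - (d - e)" for e
    by simp_all
  then have "n dvd - d - e \<longleftrightarrow> n dvd d + e" "n dvd - d + e \<longleftrightarrow> n dvd d - e" for e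
    by (metis dvd_minus_iff)+
  then show ?thesis
    unfolding step_def by blast
qed

lemma step_cases: "step n k d \<Longrightarrow> \<exists>s\<in>{1, - 1, k, - k}. n dvd d - s"
  unfolding step_def by auto

section \<open>Automorphisms\<close>

text \<open>Automorphisms are extended periodically to maps of the integers that are bijective
  modulo \<open>n\<close>.\<close>

locale circulant_aut =
  fixes n k :: int and f :: "int \<Rightarrow> int"
  assumes k: "1 < k" "2 * k < n" "2 * k + 2 \<noteq> n" "7 \<le> n"
    and dvd_iff: "n dvd f x - f y \<longleftrightarrow> n dvd x - y"
    and step_iff: "step n k (f x - f y) \<longleftrightarrow> step n k (x - y)"
    and surj: "\<exists>x. n dvd f x - z"
begin

text \<open>After a shift, \<open>w\<close> is a common neighbor of 1 and -1. If it is not 0, then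
  \<open>t - s\<close> is congruent to 2 with \<open>s \<noteq> - 1\<close> and
  \<open>t \<noteq> 1\<close>. For \<open>n \<ge> 7\<close> this needs \<open>k - 1 = 2\<close> or
  \<open>2 * k + 2 = n\<close>, which are the excluded cases.\<close>

lemma unique_middle:
  assumes "k \<noteq> 3" "step n k (w - 1)" "step n k (w + 1)"
  shows "n dvd w"
proof (rule ccontr)
  assume w: "\<not> n dvd w"
  obtain s where s: "n dvd w - 1 - s" "s = 1 \<or> s = - 1 \<or> s = k \<or> s = - k"
    using step_cases[OF assms(2)] by blast
  obtain t where t: "n dvd w + 1 - t" "t = 1 \<or> t = - 1 \<or> t = k \<or> t = - k"
    using step_cases[OF assms(3)] by blast
  have "s \<noteq> - 1" "t \<noteq> 1"
    using s t w by auto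
  moreover have "n dvd t - s - 2"
    using dvd_diff[OF s(1) t(1)] by (simp add: algebra_simps)
  then have "t - s - 2 = 0 \<or> t - s - 2 = n \<or> t - s - 2 = - n"
    by (rule dvd_small_cases) (use s t k in linarith)
  ultimately show False
    using s(2) t(2) k assms(1) by (elim disjE) linarith+
qed

text \<open>Take \<open>z\<close> above the fourth corner of the parallelogram spanned at
  \<open>f x\<close> by \<open>f (x + 1)\<close> and \<open>f (x - 1)\<close>. It is adjacent to
  \<open>x + 1\<close> and \<open>x - 1\<close>, so \<open>unique_middle\<close> gives
  \<open>z = x\<close> modulo \<open>n\<close> and the parallelogram collapses.\<close>

lemma opposite_steps:
  assumes "k \<noteq> 3"
  shows "n dvd f (x + 1) + f (x - 1) - 2 * f x"
proof -
  obtain z where z: "n dvd f z - (f (x + 1) + f (x - 1) - f x)"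
    using surj by blast
  have "step n k (f z - f (x + 1)) \<longleftrightarrow> step n k (f (x - 1) - f x)"
    by (rule step_cong) (use z in \<open>simp add: algebra_simps\<close>)
  then have "step n k (f z - f (x + 1))"
    unfolding step_iff by (simp add: step_def)
  moreover have "step n k (f z - f (x - 1)) \<longleftrightarrow> step n k (f (x + 1) - f x)"
    by (rule step_cong) (use z in \<open>simp add: algebra_simps\<close>)
  then have "step n k (f z - f (x - 1))"
    unfolding step_iff by (simp add: step_def)
  ultimately have "n dvd z - x"
    using unique_middle[OF assms, of "z - x"] unfolding step_iff by (simp add: algebra_simps)
  then have "n dvd f z - f x"
    using dvd_iff by blast
  then show ?thesis
    using dvd_diff[OF _ z, of "f z - f x"] by (simp add: algebra_simps)
qed

lemma step_1: "step n k (f 1 - f 0)"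
  unfolding step_iff by (simp add: step_def)

text \<open>If \<open>f\<close> multiplies differences by \<open>\<plusminus>k\<close>, then \<open>f k - f 0 = \<plusminus>k\<^sup>2\<close> has to be a step other
  than \<open>\<plusminus>k = f (\<plusminus>1) - f 0\<close>.\<close>

lemma affine_if_not_3:
  assumes "k \<noteq> 3"
  shows "\<exists>s. (s \<in> {1, - 1} \<or> s \<in> {k, - k} \<and> (n dvd k\<^sup>2 - 1 \<or> n dvd k\<^sup>2 + 1)) \<and>
    (\<forall>m. n dvd f (int m) - f 0 - s * int m)"
proof -
  have aff: "n dvd f (int m) - f 0 - int m * (f 1 - f 0)" for m
    by (rule affine_if_second_difference_zero) (rule opposite_steps[OF assms])
  obtain s where s: "n dvd f 1 - f 0 - s" "s = 1 \<or> s = - 1 \<or> s = k \<or> s = - k"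
    using step_cases[OF step_1] by blast
  have lin: "n dvd f (int m) - f 0 - s * int m" for m
  proof -
    have "n dvd (f (int m) - f 0 - int m * (f 1 - f 0)) + int m * (f 1 - f 0 - s)"
      by (intro dvd_add aff dvd_mult s)
    then show ?thesis
      by (simp add: algebra_simps)
  qed
  show ?thesis
  proof (cases "s = 1 \<or> s = - 1")
    case True
    then show ?thesis
      using lin by blast
  next
    case False
    then have sk: "s = k \<or> s = - k"
      using s by blast
    have nk: "int (nat k) = k"
      using k by simp
    have lk: "n dvd f k - f 0 - s * k"
      using lin[of "nat k"] nk by simp
    have "step n k (f k - f 0)"
      unfolding step_iff by (simp add: step_def)
    then have sq: "step n k (k\<^sup>2)"
      using step_cong[OF lk] sk step_minus[of n k "k\<^sup>2"] by (auto simp: power2_eq_square)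
    have "\<not> n dvd f k - f 1"
      unfolding dvd_iff using k zdvd_imp_le[of n "k - 1"] by auto
    then have "\<not> n dvd s * k - s"
      using dvd_add[OF dvd_diff[OF lk s(1)], of "s * k - s"] by auto
    then have 1: "\<not> n dvd k\<^sup>2 - k"
      using sk dvd_minus_iff[of n "k * k - k"] by (auto simp: power2_eq_square algebra_simps)
    \<comment> \<open>\<open>lin\<close> covers nonnegative arguments only, so
      \<open>f (- 1)\<close> comes from the second difference at 0.\<close>
    have "n dvd f (- 1) - f 0 + s"
      using dvd_diff[OF opposite_steps[OF assms, of 0] s(1)] by (simp add: algebra_simps)
    moreover have "\<not> n dvd f k - f (- 1)"
      unfolding dvd_iff using k zdvd_imp_le[of n "k + 1"] by auto
    ultimately have "\<not> n dvd s * k + s"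
      using dvd_add[OF dvd_diff[OF lk], of "f (- 1) - f 0 + s" "s * k + s"] by auto
    then have 2: "\<not> n dvd k\<^sup>2 + k"
      using sk dvd_minus_iff[of n "k * k + k"] by (auto simp: power2_eq_square algebra_simps)
    have "n dvd k\<^sup>2 - 1 \<or> n dvd k\<^sup>2 + 1"
      using sq 1 2 unfolding step_def by blast
    then show ?thesis
      using sk lin by blast
  qed
qed

text \<open>Incongruent witnesses are used because every vertex has infinitely many integer
  representatives.\<close>

definition three_common :: "int \<Rightarrow> int \<Rightarrow> bool" where
  "three_common x y \<longleftrightarrow> (\<exists>a b c. \<not> n dvd a - b \<and> \<not> n dvd a - c \<and> \<not> n dvd b - c \<and>
     (\<forall>z\<in>{a, b, c}. step n k (z - x) \<and> step n k (z - y)))"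

lemma three_common_preserved:
  assumes "three_common x y"
  shows "three_common (f x) (f y)"
proof -
  obtain a b c where "\<not> n dvd a - b" "\<not> n dvd a - c" "\<not> n dvd b - c"
    "\<forall>z\<in>{a, b, c}. step n k (z - x) \<and> step n k (z - y)"
    using assms unfolding three_common_def by blast
  then show ?thesis
    unfolding three_common_def
    by (intro exI[of _ "f a"] exI[of _ "f b"] exI[of _ "f c"]) (simp add: dvd_iff step_iff)
qed

section \<open>The exceptional case \<open>k = 3\<close>\<close>

context
  assumes k3: "k = 3" and n: "n \<noteq> 10"
begin

lemma three_common_2: "three_common x (x + 2)"
proof -
  have "\<not> n dvd 2" "\<not> n dvd 4"
    using k zdvd_imp_le[of n 2] zdvd_imp_le[of n 4] by auto
  then show ?thesis
    unfolding three_common_def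
    by (intro exI[of _ "x + 1"] exI[of _ "x + 3"] exI[of _ "x - 1"]) (auto simp: step_def k3)
qed

text \<open>A single common neighbor already makes \<open>y - x\<close> congruent to one of 0, 2, 4,
  6 up to sign. For 4 and 6 only two offsets from \<open>x\<close> remain possible, so two of the
  three witnesses would coincide.\<close>

lemma two_if_three_common:
  assumes xy: "three_common x y" "\<not> n dvd y - x"
  shows "n dvd y - x - 2 \<or> n dvd y - x + 2"
proof (rule ccontr)
  assume neg: "\<not> (n dvd y - x - 2 \<or> n dvd y - x + 2)"
  obtain a b c where dist: "\<not> n dvd a - b" "\<not> n dvd a - c" "\<not> n dvd b - c"
    and common: "\<And>z. z \<in> {a, b, c} \<Longrightarrow> step n k (z - x)"
      "\<And>z. z \<in> {a, b, c} \<Longrightarrow> step n k (z - y)"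
    using xy unfolding three_common_def by blast
  note steps = step_cases[of n k, unfolded k3]
  have step_a: "step n 3 (a - x)" "step n 3 (a - y)"
    using common[of a] k3 by simp_all
  obtain s where s: "s \<in> {1, - 1, 3, - 3}" "n dvd a - x - s"
    using steps[OF step_a(1)] by blast
  obtain t where t: "t \<in> {1, - 1, 3, - 3}" "n dvd a - y - t"
    using steps[OF step_a(2)] by blast
  have d: "n dvd y - x - (s - t)"
    using dvd_diff[OF s(2) t(2)] by (simp add: algebra_simps)
  \<comment> \<open>Otherwise \<open>n\<close> would divide one of 2, 4, 6, 8, 10. Here 8 is
    excluded by \<open>2 * k + 2 \<noteq> n\<close> and 10 by assumption.\<close>
  have not_step: "\<not> step n k 5" "\<not> step n k 7"
    using k n dvd_small_cases[of n 4] dvd_small_cases[of n 6] dvd_small_cases[of n 2]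
      dvd_small_cases[of n 8] dvd_small_cases[of n 10]
    by (auto simp: step_def k3)
  have "\<exists>p q. \<forall>r\<in>{1, - 1, 3, - 3}. step n k (r - (s - t)) \<longrightarrow> r = p \<or> r = q"
  proof -
    consider "s - t = 4" | "s - t = - 4" | "s - t = 6" | "s - t = - 6"
      using s(1) t(1) d neg xy(2) by auto
    then show ?thesis
    proof cases
      case 1
      then show ?thesis
        using not_step step_minus[of n k 5] step_minus[of n k 7]
        by (intro exI[of _ 1] exI[of _ 3]) auto
    next
      case 2
      then show ?thesis
        using not_step by (intro exI[of _ "- 1"] exI[of _ "- 3"]) auto
    next
      case 3
      then show ?thesis
        using not_step step_minus[of n k 5] step_minus[of n k 7]
        by (intro exI[of _ 3] exI[of _ "- 3"]) auto
    next
      case 4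
      then show ?thesis
        using not_step by (intro exI[of _ 3] exI[of _ "- 3"]) auto
    qed
  qed
  then obtain p q where pq: "\<And>r. r \<in> {1, - 1, 3, - 3} \<Longrightarrow> step n k (r - (s - t)) \<Longrightarrow> r = p \<or> r = q"
    by blast
  have "n dvd z - x - p \<or> n dvd z - x - q" if z: "z \<in> {a, b, c}" for z
  proof -
    obtain r where r: "r \<in> {1, - 1, 3, - 3}" "n dvd z - x - r"
      using steps common(1)[OF z, unfolded k3] by blast
    have "n dvd (z - y) - (r - (s - t))"
      using dvd_diff[OF r(2) d] by (simp add: algebra_simps)
    then have "step n k (r - (s - t))"
      using step_cong common(2)[OF z] by blast
    then show ?thesis
      using pq r by blast
  qed
  then have "n dvd a - x - p \<or> n dvd a - x - q" "n dvd b - x - p \<or> n dvd b - x - q"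
    "n dvd c - x - p \<or> n dvd c - x - q"
    by blast+
  moreover have "n dvd u - v" if "n dvd u - x - r" "n dvd v - x - r" for u v r
    using dvd_diff[OF that] by simp
  ultimately show False
    using dist by blast
qed

lemma distance_two:
  "(n dvd f (x + 2) - f x - 2 \<or> n dvd f (x + 2) - f x + 2) \<and> \<not> n dvd f (x + 2) - f x"
proof -
  have "\<not> n dvd f (x + 2) - f x"
    unfolding dvd_iff using k zdvd_imp_le[of n 2] by auto
  then show ?thesis
    using two_if_three_common[OF three_common_preserved[OF three_common_2]] by blast
qed

text \<open>A difference of \<open>\<plusminus>1\<close> is distinguished from \<open>\<plusminus>3\<close> by the fact that \<open>x + 1\<close> is adjacent to both
  \<open>x + 2\<close> and \<open>x - 2\<close>.\<close>

lemma unit_steps: "n dvd f (x + 1) - f x - 1 \<or> n dvd f (x + 1) - f x + 1"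
proof (rule ccontr)
  assume "\<not> ?thesis"
  moreover have "step n k (f (x + 1) - f x)"
    unfolding step_iff by (simp add: step_def)
  ultimately have three: "n dvd f (x + 1) - f x - 3 \<or> n dvd f (x + 1) - f x + 3"
    unfolding step_def k3 by blast
  have "step n k (f (x + 2) - f (x + 1))" "step n k (f (x - 2) - f (x + 1))"
    unfolding step_iff by (simp_all add: step_def k3)
  moreover have "n dvd f (x + 2) - f x - 2 \<or> n dvd f (x + 2) - f x + 2"
    using distance_two by blast
  moreover have "n dvd f (x - 2) - f x - 2 \<or> n dvd f (x - 2) - f x + 2"
    using distance_two[of "x - 2"] dvd_minus_iff[of n "f (x - 2) - f x - 2"]
      dvd_minus_iff[of n "f (x - 2) - f x + 2"] by (auto simp: algebra_simps)
  moreover have "\<not> n dvd f (x + 2) - f (x - 2)"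
    unfolding dvd_iff using k zdvd_imp_le[of n 4] by auto
  moreover have "n dvd f (x + 2) - f (x - 2)"
    if "n dvd f (x + 2) - f x - r" "n dvd f (x - 2) - f x - r" for r
    using dvd_diff[OF that] by simp
  moreover note this[of "- 2"]
  \<comment> \<open>In one order or the other, \<open>f (x + 2)\<close> and \<open>f (x - 2)\<close>
    represent \<open>f x + 2\<close> and \<open>f x - 2\<close>. One of these differs by 5 from
    \<open>f (x + 1)\<close> if that is \<open>f x + 3\<close> or \<open>f x - 3\<close>.\<close>
  ultimately have "\<exists>u. step n k (u - f (x + 1)) \<and> n dvd u - f x - 2"
    "\<exists>u. step n k (u - f (x + 1)) \<and> n dvd u - f x + 2"
    by auto
  then obtain u v where u: "step n k (u - f (x + 1))" "n dvd u - f x - 2"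
    and v: "step n k (v - f (x + 1))" "n dvd v - f x + 2"
    by blast
  have not_step: "\<not> step n k 5"
    using k n dvd_small_cases[of n 4] dvd_small_cases[of n 6] dvd_small_cases[of n 2]
      dvd_small_cases[of n 8]
    by (auto simp: step_def k3)
  from three show False
  proof
    assume 3: "n dvd f (x + 1) - f x - 3"
    have "n dvd (v - f (x + 1)) - (- 5)"
      using dvd_diff[OF v(2) 3] by (simp add: algebra_simps)
    then show False
      using step_cong[of n _ "- 5" k] v(1) not_step step_minus[of n k 5] by blast
  next
    assume 3: "n dvd f (x + 1) - f x + 3"
    have "n dvd (u - f (x + 1)) - 5"
      using dvd_diff[OF u(2) 3] by (simp add: algebra_simps)
    then show False
      using step_cong[of n _ 5 k] u(1) not_step by blast
  qed
qed

text \<open>Consecutive unit steps cannot cancel, because \<open>f (x + 1)\<close> and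
  \<open>f (x - 1)\<close> are incongruent. So they agree, and the second differences
  vanish.\<close>

lemma dihedral_if_3: "\<exists>e\<in>{1, - 1}. \<forall>m. n dvd f (int m) - f 0 - e * int m"
proof -
  have "n dvd f (x + 1) + f (x - 1) - 2 * f x" for x
  proof -
    have "\<not> n dvd f (x + 1) - f (x - 1)"
      using distance_two[of "x - 1"] by (simp add: algebra_simps)
    moreover have "n dvd f (x + 1) - f (x - 1)"
      if "n dvd f (x + 1) - f x - r" "n dvd f x - f (x - 1) + r" for r
      using dvd_add[OF that] by simp
    moreover note this[of "- 1"]
    moreover have "n dvd f x - f (x - 1) - 1 \<or> n dvd f x - f (x - 1) + 1"
      using unit_steps[of "x - 1"] by simp
    ultimately obtain r where "n dvd f (x + 1) - f x - r" "n dvd f x - f (x - 1) - r"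
      using unit_steps[of x] that[of 1] that[of "- 1"] by auto
    then have "n dvd (f (x + 1) - f x - r) - (f x - f (x - 1) - r)"
      by (rule dvd_diff)
    then show ?thesis
      by (simp add: algebra_simps)
  qed
  then have aff: "n dvd f (int m) - f 0 - int m * (f 1 - f 0)" for m
    by (rule affine_if_second_difference_zero)
  obtain e where e: "e \<in> {1, - 1}" "n dvd f 1 - f 0 - e"
    using unit_steps[of 0] that[of 1] that[of "- 1"] by auto
  have "n dvd f (int m) - f 0 - e * int m" for m
  proof -
    have "n dvd (f (int m) - f 0 - int m * (f 1 - f 0)) + int m * (f 1 - f 0 - e)"
      by (intro dvd_add aff dvd_mult e)
    then show ?thesis
      by (simp add: algebra_simps)
  qed
  then show ?thesis
    using e by blast
qed

end

end

section \<open>Rigidity of triples with distinct cyclic gaps\<close>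

text \<open>A nontrivial rotation of the triple would make all gaps equal, and a reflection would
  make two of them equal. All values lie between 0 and \<open>n\<close>, so the congruences become
  finitely many linear equations.\<close>

lemma dihedral_map_preserving_three_points:
  fixes n e a b :: int and f :: "int \<Rightarrow> int"
  assumes ab: "0 < a" "0 < b" "a + b < n" "a \<noteq> b" "n \<noteq> 2 * a + b" "n \<noteq> a + 2 * b"
    and e: "e = 1 \<or> e = - 1"
    and lin: "\<And>x. x \<in> {0, a, a + b} \<Longrightarrow> n dvd f x - f 0 - e * x"
    and inv: "\<And>x. x \<in> {0, a, a + b} \<Longrightarrow> f x \<in> {0, a, a + b}"
  shows "f 0 = 0 \<and> e = 1"
proof -
  have f: "f 0 = 0 \<or> f 0 = a \<or> f 0 = a + b" "f a = 0 \<or> f a = a \<or> f a = a + b"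
    "f (a + b) = 0 \<or> f (a + b) = a \<or> f (a + b) = a + b"
    using inv by auto
  let ?u = "f a - f 0 - e * a" and ?v = "f (a + b) - f 0 - e * (a + b)"
  have bounds: "0 \<le> f x \<and> f x \<le> a + b" if "x \<in> {0, a, a + b}" for x
    using inv[OF that] ab by auto
  have "\<bar>?u\<bar> < 2 * n" "\<bar>?v\<bar> < 2 * n"
    using e bounds[of 0] bounds[of a] bounds[of "a + b"] ab(1-3) by auto
  then have uv: "?u = 0 \<or> ?u = n \<or> ?u = - n" "?v = 0 \<or> ?v = n \<or> ?v = - n"
    using dvd_small_cases lin by blast+
  from e show ?thesis
  proof
    assume e: "e = 1"
    have "f 0 \<noteq> a"
    proof
      assume "f 0 = a"
      then show False
        using uv(2) f(3) ab unfolding e by (elim disjE) simp_all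
    qed
    moreover have "f 0 \<noteq> a + b"
    proof
      assume "f 0 = a + b"
      then show False
        using uv(1) f(2) ab unfolding e by (elim disjE) simp_all
    qed
    ultimately have "f 0 = 0"
      using f(1) by blast
    then show ?thesis
      using e by blast
  next
    assume e: "e = - 1"
    have "f 0 \<noteq> 0"
    proof
      \<comment> \<open>A reflection fixing 0 cannot swap the other two points, as
        \<open>n \<noteq> 2 * a + b\<close>. It would fix both, but only one point can be antipodal
        to 0.\<close>
      assume 0: "f 0 = 0"
      have "n = 2 * a"
        using uv(1) f(2) ab unfolding e 0 by (elim disjE) simp_all
      moreover have "n = 2 * (a + b)"
        using uv(2) f(3) ab unfolding e 0 by (elim disjE) simp_all
      ultimately show False
        using ab by simp
    qed
    moreover have "f 0 \<noteq> a"
    proof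
      assume "f 0 = a"
      then show False
        using uv(2) f(3) ab unfolding e by (elim disjE) simp_all
    qed
    moreover have "f 0 \<noteq> a + b"
    proof
      assume "f 0 = a + b"
      then show False
        using uv(1) f(2) ab unfolding e by (elim disjE) simp_all
    qed
    ultimately show ?thesis
      using f(1) by blast
  qed
qed

section \<open>Transfer between graph automorphisms and maps of the integers\<close>

definition periodic_extension :: "nat \<Rightarrow> (nat \<Rightarrow> nat) \<Rightarrow> int \<Rightarrow> int" where
  "periodic_extension n \<phi> x = int (\<phi> (nat (x mod int n)))"

lemma verts_circulant [simp]: "verts (circulant n k) = {..<n}"
  by (simp add: circulant_def)

lemma adj_circulant_iff_step:
  assumes "1 < k" "2 * k < n" "i < n" "j < n"
  shows "adj (circulant n k) i j \<longleftrightarrow> step (int n) (int k) (int i - int j)"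
proof -
  have "\<not> step (int n) (int k) 0"
    using assms(1,2) zdvd_imp_le[of "int n" 1] zdvd_imp_le[of "int n" "int k"]
    by (auto simp: step_def)
  then have "i \<noteq> j" if "step (int n) (int k) (int i - int j)"
    using that by auto
  then show ?thesis
    using assms(3,4) by (auto simp: circulant_def step_def cong_iff_dvd_diff)
qed

lemma circulant_aut_periodic_extension:
  assumes k: "1 < k" "2 * k < n" "2 * k + 2 \<noteq> n" "7 \<le> n"
    and aut: "automorphism (circulant n k) \<phi>"
  shows "circulant_aut (int n) (int k) (periodic_extension n \<phi>)"
proof
  let ?f = "periodic_extension n \<phi>"
  have bij: "bij_betw \<phi> {..<n} {..<n}"
    and adj: "\<And>u v. u < n \<Longrightarrow> v < n \<Longrightarrow>
      adj (circulant n k) (\<phi> u) (\<phi> v) \<longleftrightarrow> adj (circulant n k) u v"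
    using aut unfolding automorphism_def by auto
  have less: "\<phi> u < n" if "u < n" for u
    using bij that bij_betwE by blast
  show "1 < int k" "2 * int k < int n" "2 * int k + 2 \<noteq> int n" "7 \<le> int n"
    using k by simp_all
  fix x y z :: int
  define u where "u = nat (x mod int n)"
  define v where "v = nat (y mod int n)"
  have u: "u < n" "x mod int n = int u" and v: "v < n" "y mod int n = int v"
    using k by (simp_all add: u_def v_def nat_less_iff)
  have f: "?f x = int (\<phi> u)" "?f y = int (\<phi> v)"
    by (simp_all add: periodic_extension_def u_def v_def)
  have eq_iff: "int n dvd int i - int j \<longleftrightarrow> i = j" if "i < n" "j < n" for i j
    using that by (auto simp flip: mod_eq_dvd_iff)
  have "int n dvd x - y \<longleftrightarrow> u = v"
    using u v by (simp flip: mod_eq_dvd_iff)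
  moreover have "\<phi> u = \<phi> v \<longleftrightarrow> u = v"
    using bij u v by (meson bij_betw_imp_inj_on inj_on_eq_iff lessThan_iff)
  ultimately show "int n dvd ?f x - ?f y \<longleftrightarrow> int n dvd x - y"
    using eq_iff less u v f by simp
  have "int n dvd (x - y) - (int u - int v)"
    using u v by (metis mod_diff_eq mod_eq_dvd_iff)
  then have "step (int n) (int k) (x - y) \<longleftrightarrow> step (int n) (int k) (int u - int v)"
    by (rule step_cong)
  then show "step (int n) (int k) (?f x - ?f y) \<longleftrightarrow> step (int n) (int k) (x - y)"
    using adj[of u v] adj_circulant_iff_step[OF k(1,2)] less u v f by simp
  have "nat (z mod int n) < n"
    using k by (simp add: nat_less_iff)
  then obtain w where w: "w < n" "\<phi> w = nat (z mod int n)"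
    using bij by (metis bij_betw_def image_iff lessThan_iff)
  then have "?f (int w) = z mod int n"
    using k by (simp add: periodic_extension_def)
  then show "\<exists>x. int n dvd ?f x - z"
    by (metis dvd_minus_mod dvd_minus_iff minus_diff_eq)
qed

text \<open>Multipliers \<open>k\<close> and \<open>- k\<close> do occur, for example for
  \<open>n = 13\<close>, \<open>k = 5\<close>. The condition on \<open>k\<^sup>2\<close> is recorded
  so that they can be refuted later.\<close>

lemma automorphism_affine:
  assumes k: "1 < k" "2 * k < n" "2 * k + 2 \<noteq> n" "7 \<le> n" "(n, k) \<noteq> (10, 3)"
    and aut: "automorphism (circulant n k) \<phi>"
  shows "\<exists>s. (s \<in> {1, - 1} \<or>
      s \<in> {int k, - int k} \<and> (int n dvd (int k)\<^sup>2 - 1 \<or> int n dvd (int k)\<^sup>2 + 1)) \<and>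
    (\<forall>x<n. int n dvd int (\<phi> x) - int (\<phi> 0) - s * int x)"
proof -
  interpret circulant_aut "int n" "int k" "periodic_extension n \<phi>"
    by (rule circulant_aut_periodic_extension[OF k(1-4) aut])
  have "\<exists>s. (s \<in> {1, - 1} \<or>
      s \<in> {int k, - int k} \<and> (int n dvd (int k)\<^sup>2 - 1 \<or> int n dvd (int k)\<^sup>2 + 1)) \<and>
    (\<forall>m. int n dvd periodic_extension n \<phi> (int m) - periodic_extension n \<phi> 0 - s * int m)"
  proof (cases "k = 3")
    case True
    then show ?thesis
      using dihedral_if_3 assms(5) by auto
  next
    case False
    then show ?thesis
      using affine_if_not_3 by simp
  qed
  moreover have "periodic_extension n \<phi> (int x) = int (\<phi> x)" if "x < n" for x
    using that by (simp add: periodic_extension_def)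
  ultimately show ?thesis
    using assms(4)
    by (metis (no_types, opaque_lifting) gr_zeroI not_less_zero of_nat_0 zero_less_numeral
        not_numeral_le_zero)
qed

section \<open>Recoloring an independent set\<close>

lemma optimal_coloring:
  assumes "finite (verts G)" "simple_graph G"
  shows "\<exists>c. proper_coloring G c \<and> card (c ` verts G) = chromatic_number G"
  unfolding chromatic_number_def
  by (rule LeastI_ex) (use ex_proper_distinguishing_coloring[OF assms] in blast)

lemma clique_card_le_chromatic_number:
  assumes "finite (verts G)" "simple_graph G" "T \<subseteq> verts G"
    and "\<And>u v. u \<in> T \<Longrightarrow> v \<in> T \<Longrightarrow> u \<noteq> v \<Longrightarrow> adj G u v"
  shows "card T \<le> chromatic_number G"
proof -
  obtain c where c: "proper_coloring G c" "card (c ` verts G) = chromatic_number G"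
    using optimal_coloring[OF assms(1,2)] by blast
  have "inj_on c T"
    using c(1) assms(3,4) unfolding proper_coloring_def inj_on_def by blast
  then have "card T = card (c ` T)"
    by (simp add: card_image)
  also have "\<dots> \<le> card (c ` verts G)"
    using assms by (intro card_mono image_mono finite_imageI) auto
  finally show ?thesis
    by (simp add: c)
qed

lemma distinguishing_chromatic_number_le:
  assumes "proper_coloring G c" "distinguishing G c"
  shows "distinguishing_chromatic_number G \<le> card (c ` verts G)"
  unfolding distinguishing_chromatic_number_def
  using assms by (intro Least_le) blast

text \<open>The fresh color occurs exactly on \<open>S\<close>, so color-preserving automorphisms
  map \<open>S\<close> into itself.\<close>

lemma extra_color_bound:
  assumes fin: "finite (verts G)" and G: "simple_graph G" and S: "S \<subseteq> verts G"
    and indep: "\<And>u v. u \<in> S \<Longrightarrow> v \<in> S \<Longrightarrow> \<not> adj G u v"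
    and rigid: "\<And>\<phi> v. automorphism G \<phi> \<Longrightarrow> (\<And>u. u \<in> S \<Longrightarrow> \<phi> u \<in> S) \<Longrightarrow>
      v \<in> verts G \<Longrightarrow> \<phi> v = v"
  shows "distinguishing_chromatic_number G \<le> chromatic_number G + 1"
proof -
  obtain c where c: "proper_coloring G c" "card (c ` verts G) = chromatic_number G"
    using optimal_coloring[OF fin G] by blast
  obtain new where new: "new \<notin> c ` verts G"
    using fin by (meson ex_new_if_finite finite_imageI infinite_UNIV_nat)
  define c' where "c' v = (if v \<in> S then new else c v)" for v
  have "proper_coloring G c'"
    using c(1) new indep unfolding proper_coloring_def c'_def by (auto simp: image_iff)
  moreover have "distinguishing G c'"
    unfolding distinguishing_def
  proof (intro allI impI ballI)
    fix \<phi> v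
    assume \<phi>: "automorphism G \<phi> \<and> (\<forall>v\<in>verts G. c' (\<phi> v) = c' v)" and v: "v \<in> verts G"
    have "\<phi> u \<in> S" if "u \<in> S" for u
    proof -
      have "\<phi> u \<in> verts G" "c' (\<phi> u) = c' u"
        using \<phi> that S unfolding automorphism_def by (auto dest: bij_betwE)
      then show ?thesis
        using that new unfolding c'_def by (auto split: if_splits)
    qed
    then show "\<phi> v = v"
      using rigid \<phi> v by blast
  qed
  ultimately have "distinguishing_chromatic_number G \<le> card (c' ` verts G)"
    by (rule distinguishing_chromatic_number_le)
  \<comment> \<open>Only an inequality: recoloring may empty an old color class.\<close>
  also have "\<dots> \<le> card (insert new (c ` verts G))"
    using fin by (intro card_mono) (auto simp: c'_def)
  finally show ?thesis
    using c new fin by simp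
qed

text \<open>\<open>ab\<close> makes the three cyclic gaps distinct and larger than 1;
  \<open>indep\<close> keeps them away from \<open>k\<close> and \<open>n - k\<close>.
  \<open>dihedral\<close> concerns only automorphisms preserving the triple, so that graphs with
  multiplier \<open>k\<close> or \<open>- k\<close> are covered too.\<close>

lemma three_point_bound:
  assumes k: "1 < k" "2 * k < n" "2 * k + 2 \<noteq> n" "7 \<le> n" "(n, k) \<noteq> (10, 3)"
    and ab: "1 < a" "1 < b" "a + b + 1 < n" "a \<noteq> b" "n \<noteq> 2 * a + b" "n \<noteq> a + 2 * b"
    and indep: "k \<noteq> a" "k \<noteq> b" "k \<noteq> a + b" "n \<noteq> a + k" "n \<noteq> b + k" "n \<noteq> a + b + k"
    and dihedral: "\<And>\<phi>. automorphism (circulant n k) \<phi> \<Longrightarrow>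
      (\<And>u. u \<in> {0, a, a + b} \<Longrightarrow> \<phi> u \<in> {0, a, a + b}) \<Longrightarrow>
      \<exists>e\<in>{1, - 1}. \<forall>x<n. int n dvd int (\<phi> x) - int (\<phi> 0) - e * int x"
  shows "distinguishing_chromatic_number (circulant n k) \<le> chromatic_number (circulant n k) + 1"
proof (rule extra_color_bound)
  show "finite (verts (circulant n k))"
    by simp
  show "simple_graph (circulant n k)"
    by (rule simple_graph_circulant)
  show "{0, a, a + b} \<subseteq> verts (circulant n k)"
    using ab by auto
next
  have no_step: "\<not> step (int n) (int k) (int d)"
    if d: "1 < d" "d + 1 < n" "k \<noteq> d" "n \<noteq> d + k" for d
  proof
    assume "step (int n) (int k) (int d)"
    then obtain s where s: "int n dvd int d - s" "s = 1 \<or> s = - 1 \<or> s = int k \<or> s = - int k"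
      using step_cases by blast
    have "\<bar>int d - s\<bar> < 2 * int n"
      using s(2) d(1,2) k(1,2) by auto
    then have "int d - s = 0 \<or> int d - s = int n \<or> int d - s = - int n"
      using dvd_small_cases s(1) by blast
    then show False
      using s(2) d k(1,2) by auto
  qed
  have no_step_ab: "\<not> step (int n) (int k) (int a)" "\<not> step (int n) (int k) (int b)"
    "\<not> step (int n) (int k) (int (a + b))"
    using ab indep no_step[of a] no_step[of b] no_step[of "a + b"] by auto
  have no_step_0: "\<not> step (int n) (int k) 0"
    using k zdvd_imp_le[of "int n" 1] zdvd_imp_le[of "int n" "int k"]
    by (auto simp: step_def)
  fix u v assume "u \<in> {0, a, a + b}" "v \<in> {0, a, a + b}"
  then have "\<not> step (int n) (int k) (int u - int v)"
    using no_step_ab no_step_0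
      step_minus[of "int n" "int k" "int a"] step_minus[of "int n" "int k" "int b"]
      step_minus[of "int n" "int k" "int (a + b)"]
    by auto
  moreover have "u < n" "v < n"
    using \<open>u \<in> _\<close> \<open>v \<in> _\<close> ab by auto
  ultimately show "\<not> adj (circulant n k) u v"
    using adj_circulant_iff_step k by blast
next
  fix \<phi> v
  assume aut: "automorphism (circulant n k) \<phi>"
    and S: "\<And>u. u \<in> {0, a, a + b} \<Longrightarrow> \<phi> u \<in> {0, a, a + b}"
    and v: "v \<in> verts (circulant n k)"
  obtain e where e: "e \<in> {1, - 1}"
    and lin: "\<And>x. x < n \<Longrightarrow> int n dvd int (\<phi> x) - int (\<phi> 0) - e * int x"
    using dihedral[OF aut S] by blast
  define f where "f x = int (\<phi> (nat x))" for x
  have "f 0 = 0 \<and> e = 1"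
  proof (rule dihedral_map_preserving_three_points[of "int a" "int b" "int n" e f])
    fix x assume x: "x \<in> {0, int a, int a + int b}"
    then have "nat x \<in> {0, a, a + b}" "int (nat x) = x"
      by auto
    moreover have "nat x < n"
      using x ab by auto
    ultimately show "int n dvd f x - f 0 - e * x" "f x \<in> {0, int a, int a + int b}"
      using lin[of "nat x"] S[of "nat x"] by (auto simp: f_def)
  qed (use ab e in auto)
  then have "int n dvd int (\<phi> v) - int v"
    using lin[of v] v by (simp add: f_def)
  moreover have "\<phi> v < n"
    using aut v unfolding automorphism_def by (auto dest: bij_betwE)
  ultimately show "\<phi> v = v"
    using v by (simp flip: mod_eq_dvd_iff)
qed

section \<open>Arithmetic exclusion of the multipliers \<open>k\<close> and
  \<open>- k\<close>\<close>

text \<open>For \<open>k = 2\<close> the numbers are 3 and 5. If \<open>n = 2 * k + 1\<close>, then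
  \<open>2 * k\<close> is congruent to -1, and four times the numbers are congruent to -3 and
  5.\<close>

lemma square_not_pm1:
  assumes "7 \<le> n" "k = 2 \<or> n = 2 * k + 1"
  shows "\<not> int n dvd (int k)\<^sup>2 - 1" "\<not> int n dvd (int k)\<^sup>2 + 1"
proof -
  have n35: "\<not> int n dvd 3" "\<not> int n dvd 5"
    using assms(1) zdvd_imp_le[of "int n" 3] zdvd_imp_le[of "int n" 5] by auto
  from assms(2) have "\<not> int n dvd (int k)\<^sup>2 - 1 \<and> \<not> int n dvd (int k)\<^sup>2 + 1"
  proof
    assume "n = 2 * k + 1"
    then have "4 * ((int k)\<^sup>2 - 1) = int n * (2 * int k - 1) - 3"
      "4 * ((int k)\<^sup>2 + 1) = int n * (2 * int k - 1) + 5"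
      by (simp_all add: power2_eq_square algebra_simps)
    then show ?thesis
      using n35 by (metis dvd_mult dvd_diff_right_iff dvd_add_right_iff dvd_triv_left)
  qed (use n35 in simp)
  then show "\<not> int n dvd (int k)\<^sup>2 - 1" "\<not> int n dvd (int k)\<^sup>2 + 1"
    by blast+
qed

text \<open>If \<open>3 * k\<close> is congruent to \<open>t\<close> and \<open>k\<^sup>2\<close> to
  \<open>r\<close>, computing \<open>3 * k\<^sup>2\<close> in two ways gives
  \<open>n dvd t * k - 3 * r\<close>. This number is nonzero for \<open>k \<ge> 4\<close> and
  smaller than \<open>n\<close> in absolute value.\<close>

lemma square_not_pm1_if_3k:
  assumes "4 \<le> k" "2 * k + 2 < n" "n = 3 * k + 1 \<or> n + 1 = 3 * k"
  shows "\<not> (int n dvd (int k)\<^sup>2 - 1 \<or> int n dvd (int k)\<^sup>2 + 1)"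
proof
  assume sq: "int n dvd (int k)\<^sup>2 - 1 \<or> int n dvd (int k)\<^sup>2 + 1"
  have "int n = 3 * int k + 1 \<or> int n = 3 * int k - 1"
    using assms by auto
  then obtain t where t: "int n = 3 * int k - t" "t = 1 \<or> t = - 1"
    by force
  obtain r where r: "int n dvd (int k)\<^sup>2 - r" "r = 1 \<or> r = - 1"
    using sq by force
  have "int n dvd 3 * ((int k)\<^sup>2 - r) - int k * int n"
    using r(1) by (meson dvd_diff dvd_mult dvd_refl)
  then have *: "int n dvd t * int k - 3 * r"
    unfolding t(1) by (simp add: power2_eq_square algebra_simps)
  have "\<bar>t * int k - 3 * r\<bar> < int n" "t * int k - 3 * r \<noteq> 0"
    using t(2) r(2) assms by auto
  then show False
    using * dvd_imp_le_int[of "t * int k - 3 * r" "int n"] by linarith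
qed

lemma automorphism_dihedral:
  assumes "1 < k" "2 * k < n" "2 * k + 2 \<noteq> n" "7 \<le> n" "(n, k) \<noteq> (10, 3)"
    and "k = 2 \<or> k = 3 \<or> n = 2 * k + 1"
    and "automorphism (circulant n k) \<phi>"
  shows "\<exists>e\<in>{1, - 1}. \<forall>x<n. int n dvd int (\<phi> x) - int (\<phi> 0) - e * int x"
proof -
  have "\<not> (int n dvd (int k)\<^sup>2 - 1 \<or> int n dvd (int k)\<^sup>2 + 1)"
  proof (cases "k = 3")
    case True
    then show ?thesis
      using assms(3-5) dvd_small_cases[of "int n" 8] dvd_small_cases[of "int n" 10] by auto
  next
    case False
    then show ?thesis
      using assms(4,6) square_not_pm1 by blast
  qed
  then show ?thesis
    using automorphism_affine[OF assms(1-5,7)] by blast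
qed

text \<open>A multiplier \<open>k\<close> or \<open>- k\<close> sends the difference 2 to
  \<open>2 * k\<close> up to sign, while differences within the triple are 0, 2,
  \<open>k - 1\<close>, \<open>k + 1\<close> up to sign. By size this leaves only
  \<open>n = 3 * k + 1\<close> and \<open>n = 3 * k - 1\<close>, where
  \<open>square_not_pm1_if_3k\<close> applies.\<close>

lemma dihedral_if_preserving_generic_triple:
  assumes k: "4 \<le> k" "2 * k + 2 < n"
    and aut: "automorphism (circulant n k) \<phi>"
    and S: "\<And>u. u \<in> {0, 2, k + 1} \<Longrightarrow> \<phi> u \<in> {0, 2, k + 1}"
  shows "\<exists>e\<in>{1, - 1}. \<forall>x<n. int n dvd int (\<phi> x) - int (\<phi> 0) - e * int x"
proof -
  obtain s where s: "s \<in> {1, - 1} \<or>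
      s \<in> {int k, - int k} \<and> (int n dvd (int k)\<^sup>2 - 1 \<or> int n dvd (int k)\<^sup>2 + 1)"
    and lin: "\<forall>x<n. int n dvd int (\<phi> x) - int (\<phi> 0) - s * int x"
    using automorphism_affine[OF _ _ _ _ _ aut] k by force
  have "s \<in> {1, - 1}"
  proof (rule ccontr)
    assume "s \<notin> {1, - 1}"
    then have sk: "s = int k \<or> s = - int k"
      and "int n dvd (int k)\<^sup>2 - 1 \<or> int n dvd (int k)\<^sup>2 + 1"
      using s by auto
    then have n: "n \<noteq> 3 * k + 1" "n + 1 \<noteq> 3 * k"
      using square_not_pm1_if_3k k by blast+
    define d where "d = int (\<phi> 2) - int (\<phi> 0)"
    have d: "d = 0 \<or> d = 2 \<or> d = - 2 \<or> d = int k + 1 \<or> d = - int k - 1 \<or>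
        d = int k - 1 \<or> d = 1 - int k"
      using S[of 0] S[of 2] by (auto simp: d_def)
    have "int n dvd d - s * 2"
      using lin k by (auto simp: d_def dest: spec[of _ 2])
    moreover have "\<bar>d - s * 2\<bar> < 2 * int n"
      using d sk k by auto
    ultimately have "d - s * 2 = 0 \<or> d - s * 2 = int n \<or> d - s * 2 = - int n"
      by (rule dvd_small_cases)
    then show False
      using sk d k n by (elim disjE) auto
  qed
  then show ?thesis
    using lin by blast
qed

section \<open>Small graphs\<close>

text \<open>An executable test: position \<open>i\<close> of \<open>rotate d L\<close> holds the
  color of vertex \<open>i + d\<close> modulo the length.\<close>

definition proper_list :: "nat \<Rightarrow> nat list \<Rightarrow> bool" where
  "proper_list k L \<longleftrightarrow> list_all2 (\<noteq>) L (rotate 1 L) \<and> list_all2 (\<noteq>) L (rotate k L)"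

text \<open>The list \<open>hd L # rev (tl L)\<close> is the pullback of \<open>L\<close> under \<open>x \<mapsto> - x\<close>.\<close>

definition dihedrally_rigid_list :: "nat list \<Rightarrow> bool" where
  "dihedrally_rigid_list L \<longleftrightarrow> (\<forall>b\<in>set [1..<length L]. rotate b L \<noteq> L) \<and>
     (\<forall>b\<in>set [0..<length L]. rotate b L \<noteq> hd L # rev (tl L))"

lemma proper_coloring_list:
  assumes k: "1 < k" "2 * k < n" and L: "length L = n" "proper_list k L"
  shows "proper_coloring (circulant n k) ((!) L)"
proof -
  have edge: "L ! u \<noteq> L ! v" if uv: "u < n" "v < n"
    and d: "int n dvd int v - int u - int d" "d = 1 \<or> d = k" for u v d
  proof -
    have "int v mod int n = (int u + int d) mod int n"
      using d(1) by (simp add: mod_eq_dvd_iff algebra_simps)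
    then have "v = (u + d) mod n"
      using uv by (metis mod_less of_nat_add of_nat_eq_iff zmod_int)
    moreover have "list_all2 (\<noteq>) L (rotate d L)"
      using L(2) d(2) unfolding proper_list_def by blast
    then have "L ! u \<noteq> rotate d L ! u"
      using list_all2_nthD uv(1) L(1) by blast
    ultimately show ?thesis
      using uv(1) L(1) by (simp add: nth_rotate add.commute)
  qed
  have "L ! u \<noteq> L ! v" if uv: "u < n" "v < n" "step (int n) (int k) (int u - int v)" for u v
  proof -
    consider "int n dvd int u - int v - int 1" | "int n dvd int u - int v + int 1"
      | "int n dvd int u - int v - int k" | "int n dvd int u - int v + int k"
      using uv(3) unfolding step_def by auto
    then show ?thesis
    proof cases
      case 1
      then show ?thesis
        using edge[OF uv(2,1)] by metis
    next
      case 2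
      then show ?thesis
        using edge[OF uv(1,2), of 1] dvd_minus_iff[of "int n" "int u - int v + int 1"]
        by (simp add: algebra_simps)
    next
      case 3
      then show ?thesis
        using edge[OF uv(2,1)] by metis
    next
      case 4
      then show ?thesis
        using edge[OF uv(1,2), of k] dvd_minus_iff[of "int n" "int u - int v + int k"]
        by (simp add: algebra_simps)
    qed
  qed
  then show ?thesis
    using adj_circulant_iff_step[OF k] by (auto simp: proper_coloring_def)
qed

text \<open>A color-preserving rotation makes \<open>rotate (\<phi> 0) L\<close> equal to
  \<open>L\<close>; a reflection makes it equal to the reversed list. The two list checks leave only
  the rotation by 0.\<close>

lemma distinguishing_list:
  assumes dihedral: "\<And>\<phi>. automorphism (circulant n k) \<phi> \<Longrightarrow>
      \<exists>e\<in>{1, - 1}. \<forall>x<n. int n dvd int (\<phi> x) - int (\<phi> 0) - e * int x"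
    and L: "length L = n" "dihedrally_rigid_list L"
  shows "distinguishing (circulant n k) ((!) L)"
  unfolding distinguishing_def
proof (intro allI impI ballI)
  fix \<phi> v
  assume \<phi>: "automorphism (circulant n k) \<phi> \<and> (\<forall>v\<in>verts (circulant n k). L ! \<phi> v = L ! v)"
    and v: "v \<in> verts (circulant n k)"
  have less: "\<phi> x < n" if "x < n" for x
    using \<phi> that unfolding automorphism_def by (auto dest: bij_betwE)
  have col: "L ! \<phi> x = L ! x" if "x < n" for x
    using \<phi> that by simp
  have "0 < n"
    using v by auto
  obtain e where e: "e \<in> {1, - 1}"
    and lin: "\<And>x. x < n \<Longrightarrow> int n dvd int (\<phi> x) - int (\<phi> 0) - e * int x"
    using dihedral \<phi> by blast
  have pos: "\<phi> x = (\<phi> 0 + y) mod n" if "x < n" "int n dvd int y - e * int x" for x y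
  proof -
    have "int n dvd (int (\<phi> x) - int (\<phi> 0) - e * int x) - (int y - e * int x)"
      by (rule dvd_diff[OF lin[OF that(1)] that(2)])
    then have "int (\<phi> x) mod int n = (int (\<phi> 0) + int y) mod int n"
      by (simp add: mod_eq_dvd_iff algebra_simps)
    then show ?thesis
      using less[OF that(1)] by (metis mod_less of_nat_add of_nat_eq_iff zmod_int)
  qed
  have "e = 1"
  proof (rule ccontr)
    assume "e \<noteq> 1"
    then have e: "e = - 1"
      using e by blast
    have "rotate (\<phi> 0) L ! y = (hd L # rev (tl L)) ! y" if "y < n" for y
    proof -
      \<comment> \<open>This is \<open>- y\<close> modulo \<open>n\<close>; the outer
        \<open>mod\<close> matters for \<open>y = 0\<close>.\<close>
      define x where "x = (n - y) mod n"
      have x: "x < n"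
        using \<open>0 < n\<close> by (simp add: x_def)
      have "int x mod int n = (int n - int y) mod int n"
        using that by (simp add: x_def zmod_int of_nat_diff)
      then have "int n dvd int x + int y"
        by (simp add: mod_eq_dvd_iff)
      then have "\<phi> x = (\<phi> 0 + y) mod n"
        using x e by (intro pos) (simp_all add: add.commute)
      then have "L ! ((\<phi> 0 + y) mod n) = L ! x"
        using col[OF x] by simp
      moreover have "(hd L # rev (tl L)) ! y = L ! x"
      proof (cases y)
        case 0
        then show ?thesis
          using L(1) \<open>0 < n\<close> by (auto simp: x_def hd_conv_nth)
      next
        case (Suc z)
        then have "n - Suc (Suc z) < length (tl L)"
          using L(1) that by simp
        then show ?thesis
          using Suc L(1) that by (simp add: x_def rev_nth nth_tl Suc_diff_Suc)
      qed
      ultimately show ?thesis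
        using that L(1) by (simp add: nth_rotate)
    qed
    then have "rotate (\<phi> 0) L = hd L # rev (tl L)"
      using L(1) \<open>0 < n\<close> by (intro nth_equalityI) auto
    then show False
      using L less[OF \<open>0 < n\<close>] unfolding dihedrally_rigid_list_def by auto
  qed
  then have tr: "\<phi> x = (\<phi> 0 + x) mod n" if "x < n" for x
    using that by (intro pos) auto
  have "rotate (\<phi> 0) L ! x = L ! x" if "x < n" for x
    using that L(1) tr[OF that] col[OF that] by (simp add: nth_rotate)
  then have "rotate (\<phi> 0) L = L"
    using L(1) by (intro nth_equalityI) auto
  then have "\<phi> 0 = 0"
    using L less[OF \<open>0 < n\<close>] unfolding dihedrally_rigid_list_def by force
  then show "\<phi> v = v"
    using tr v by simp
qed

text \<open>A triangle forces chromatic number at least 3, so four colors are within the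
  bound.\<close>

lemma four_list_bound:
  assumes k: "1 < k" "2 * k < n" "2 * k + 2 \<noteq> n" "7 \<le> n" "(n, k) \<noteq> (10, 3)"
    and dihedral: "k = 2 \<or> k = 3 \<or> n = 2 * k + 1"
    and triangle: "k = 2 \<or> n = 2 * k + 1 \<or> n = 3 * k"
    and L: "length L = n" "\<forall>c\<in>set L. c < 4" "proper_list k L" "dihedrally_rigid_list L"
  shows "distinguishing_chromatic_number (circulant n k) \<le> chromatic_number (circulant n k) + 1"
proof -
  let ?G = "circulant n k"
  \<comment> \<open>A third vertex for the edge from 0 to \<open>k\<close>: the triangle closes by
    \<open>1 + 1 = k\<close>, \<open>k + 1 + k = n\<close> or \<open>k + k + k = n\<close>.\<close>
  have "\<exists>q<n. q \<notin> {0, k} \<and> adj ?G 0 q \<and> adj ?G k q"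
  proof -
    consider "k = 2" | "n = 2 * k + 1" | "n = 3 * k"
      using triangle by blast
    then show ?thesis
    proof cases
      case 1
      then show ?thesis
        using k by (intro exI[of _ 1]) (simp add: adj_circulant_iff_step step_def)
    next
      case 2
      moreover have "1 + 2 * int k dvd - (2 * int k) - 1"
        by (rule dvdI[of _ _ "- 1"]) simp
      ultimately show ?thesis
        using k by (intro exI[of _ "k + 1"]) (simp add: adj_circulant_iff_step step_def)
    next
      case 3
      then show ?thesis
        using k by (intro exI[of _ "2 * k"]) (simp add: adj_circulant_iff_step step_def)
    qed
  qed
  then obtain q where q: "q < n" "q \<notin> {0, k}" "adj ?G 0 q" "adj ?G k q"
    by blast
  moreover have "adj ?G 0 k"
    using k by (simp add: adj_circulant_iff_step step_def)
  moreover have "adj ?G u v \<Longrightarrow> adj ?G v u" for u v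
    using simple_graph_circulant unfolding simple_graph_def by blast
  ultimately have "card {0, k, q} \<le> chromatic_number ?G"
    using k by (intro clique_card_le_chromatic_number) (auto simp: simple_graph_circulant)
  then have "3 \<le> chromatic_number ?G"
    using q k by auto
  moreover have "distinguishing_chromatic_number ?G \<le> card ((!) L ` verts ?G)"
    using k L dihedral
    by (intro distinguishing_chromatic_number_le proper_coloring_list distinguishing_list
        automorphism_dihedral) auto
  moreover have "(!) L ` verts ?G \<subseteq> {..<4}"
    using L(1,2) by auto
  then have "card ((!) L ` verts ?G) \<le> card {..<4 :: nat}"
    by (intro card_mono) auto
  ultimately show ?thesis
    by simp
qed

text \<open>Order 5 is below the range of the automorphism argument, but the graph is complete, and
  no coloring of five vertices has more than five colors.\<close>

lemma circulant_5_2: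
  "distinguishing_chromatic_number (circulant 5 2) \<le> chromatic_number (circulant 5 2) + 1"
proof -
  have "adj (circulant 5 2) u v" if "u < 5" "v < 5" "u \<noteq> v" for u v
  proof -
    have "u \<in> {0, 1, 2, 3, 4}" "v \<in> {0, 1, 2, 3, 4}"
      using that by auto
    then show ?thesis
      using that by (auto simp: adj_circulant_iff_step step_def)
  qed
  then have "card {..<5 :: nat} \<le> chromatic_number (circulant 5 2)"
    by (intro clique_card_le_chromatic_number simple_graph_circulant) auto
  moreover obtain c where "proper_coloring (circulant 5 2) c" "distinguishing (circulant 5 2) c"
    using ex_proper_distinguishing_coloring[of "circulant 5 2"] simple_graph_circulant by auto
  then have "distinguishing_chromatic_number (circulant 5 2) \<le> card (c ` {..<5})"
    using distinguishing_chromatic_number_le by fastforce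
  moreover have "card (c ` {..<5 :: nat}) \<le> card {..<5 :: nat}"
    by (intro card_image_le) simp
  ultimately show ?thesis
    by simp
qed

text \<open>For these parameters no three distinct admissible gaps sum to \<open>n\<close>. For
  \<open>k = 2\<close>, say, gaps are at least 3, and \<open>3 + 4 + 5 = 12\<close>.\<close>

definition small_colorings :: "(nat \<times> nat \<times> nat list) list" where
  "small_colorings =
    [(7, 2, [0, 1, 2, 0, 1, 2, 3]),
     (8, 2, [0, 1, 2, 0, 3, 1, 2, 3]),
     (9, 2, [0, 1, 2, 0, 1, 2, 0, 1, 3]),
     (10, 2, [0, 1, 2, 0, 1, 2, 0, 1, 2, 3]),
     (11, 2, [0, 1, 2, 0, 1, 2, 0, 3, 1, 2, 3]),
     (7, 3, [0, 1, 0, 1, 2, 3, 2]),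
     (9, 3, [0, 1, 0, 1, 0, 1, 2, 3, 2]),
     (9, 4, [0, 1, 0, 2, 1, 2, 3, 1, 3]),
     (11, 5, [0, 1, 0, 1, 0, 1, 2, 3, 2, 3, 2])]"

lemma small_colorings_valid:
  "list_all (\<lambda>(n, k, L). length L = n \<and> (\<forall>c\<in>set L. c < 4) \<and> proper_list k L \<and>
     dihedrally_rigid_list L) small_colorings"
  by code_simp

lemma small_coloring_bound:
  assumes "(n, k, L) \<in> set small_colorings"
  shows "distinguishing_chromatic_number (circulant n k) \<le> chromatic_number (circulant n k) + 1"
proof (rule four_list_bound)
  show "length L = n" "\<forall>c\<in>set L. c < 4" "proper_list k L" "dihedrally_rigid_list L"
    using assms small_colorings_valid unfolding list_all_iff by blast+
qed (use assms in \<open>auto simp: small_colorings_def\<close>)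

section \<open>Choice of the gaps in each range of \<open>k\<close> and \<open>n\<close>\<close>

theorem mainTheorem2:
  fixes n k :: nat
  assumes "1 < k" and "real k < real n / 2"
    and "real k \<noteq> real n / 2 - 1"
    and "(n, k) \<noteq> (10, 3)"
  shows "distinguishing_chromatic_number (circulant n k) \<le> chromatic_number (circulant n k) + 1"
proof -
  have k: "1 < k" "2 * k < n" "2 * k + 2 \<noteq> n"
    using assms by (auto simp: field_simps)
  consider (two) "k = 2" | (three) "k = 3" | (half) "4 \<le> k" "n = 2 * k + 1"
    | (generic) "4 \<le> k" "2 * k + 2 < n"
    using k by linarith
  then show ?thesis
  proof cases
    case two
    \<comment> \<open>\<open>n = 6\<close> is excluded by
      \<open>2 * k + 2 \<noteq> n\<close>.\<close>
    then consider "n = 5" | "n \<in> {7, 8, 9, 10, 11}" | "12 \<le> n"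
      using k by force
    then show ?thesis
    proof cases
      case 1
      then show ?thesis
        using two circulant_5_2 by simp
    next
      case 2
      then have "\<exists>L. (n, k, L) \<in> set small_colorings"
        using two by (auto simp: small_colorings_def)
      then show ?thesis
        using small_coloring_bound by blast
    next
      case 3
      show ?thesis
      proof (rule three_point_bound[of k n 3 4])
        fix \<phi>
        assume "automorphism (circulant n k) \<phi>"
        then show "\<exists>e\<in>{1, - 1}. \<forall>x<n. int n dvd int (\<phi> x) - int (\<phi> 0) - e * int x"
          by (intro automorphism_dihedral) (use two 3 k assms(4) in auto)
      qed (use two 3 k assms(4) in auto)
    qed
  next
    case three
    then consider "n \<in> {7, 9}" | "11 \<le> n"
      using k assms(4) by force
    then show ?thesis
    proof cases
      case 1
      then have "\<exists>L. (n, k, L) \<in> set small_colorings"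
        using three by (auto simp: small_colorings_def)
      then show ?thesis
        using small_coloring_bound by blast
    next
      case 2
      show ?thesis
      proof (rule three_point_bound[of k n 2 4])
        fix \<phi>
        assume "automorphism (circulant n k) \<phi>"
        then show "\<exists>e\<in>{1, - 1}. \<forall>x<n. int n dvd int (\<phi> x) - int (\<phi> 0) - e * int x"
          by (intro automorphism_dihedral) (use three 2 k assms(4) in auto)
      qed (use three 2 k assms(4) in auto)
    qed
  next
    case half
    then consider "k \<in> {4, 5}" | "6 \<le> k"
      by force
    then show ?thesis
    proof cases
      case 1
      then have "\<exists>L. (n, k, L) \<in> set small_colorings"
        using half by (auto simp: small_colorings_def)
      then show ?thesis
        using small_coloring_bound by blast
    next
      case 2
      show ?thesis
      \<comment> \<open>The gaps are 2, 3 and \<open>2 * k - 4\<close>. For \<open>k = 5\<close> the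
        sum \<open>2 + 3\<close> would be a step, hence the bound \<open>6 \<le> k\<close>.\<close>
      proof (rule three_point_bound[of k n 2 3])
        fix \<phi>
        assume "automorphism (circulant n k) \<phi>"
        then show "\<exists>e\<in>{1, - 1}. \<forall>x<n. int n dvd int (\<phi> x) - int (\<phi> 0) - e * int x"
          by (intro automorphism_dihedral) (use half 2 k assms(4) in auto)
      qed (use half 2 k assms(4) in auto)
    qed
  next
    case generic
    \<comment> \<open>The gaps are 2, \<open>k - 1\<close> and \<open>n - k - 1\<close>, the last at
      least \<open>k + 2\<close>, so they are distinct and none is \<open>k\<close> or
      \<open>n - k\<close>.\<close>
    have sum: "2 + (k - 1) = k + 1"
      using k by simp
    show ?thesis
    proof (rule three_point_bound[of k n 2 "k - 1", unfolded sum])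
      fix \<phi>
      assume "automorphism (circulant n k) \<phi>"
        and "\<And>u. u \<in> {0, 2, k + 1} \<Longrightarrow> \<phi> u \<in> {0, 2, k + 1}"
      then show "\<exists>e\<in>{1, - 1}. \<forall>x<n. int n dvd int (\<phi> x) - int (\<phi> 0) - e * int x"
        by (rule dihedral_if_preserving_generic_triple[OF generic])
    qed (use generic in auto)
  qed
qed

end
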